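(* Let $H$ be a finite graph, possibly with loops, that is a bipartite swapping target. Then for every finite simple graph $G$ there is an injective map \[ \phi:\operatorname{Hom}(G \sqcup G, H) \to \operatorname{Hom}(G \times K_2, H) \] given by swapping, i.e. such that for every $f\in\operatorname{Hom}(G\sqcup G,H)$ there is a set $W\subseteq V(G)$ with $\operatorname{pair}(\phi(f))=\operatorname{swap}(\operatorname{pair}(f),W)$.
   Context: All graphs are finite and undirected; $G$ is simple; $H$ may have loops but no multiple edges. $\operatorname{Hom}(G,H)$ is the set of maps $f:V(G)\to V(H)$ with $f(u)f(v)\in E(H)$ for all $uv\in E(G)$ ($vv$ denotes a loop at $v$). Both $G \sqcup G$ and $G \times K_2$ have vertex set $\{v_i : v \in V(G), i \in \{0,1\}\}$; the edges of $G\sqcup G$ are $u_iv_i$ and the edges of $G\times K_2$ are $u_iv_{1-i}$, for $uv\in E(G)$ and $i\in\{0,1\}$. An $H$-pair-labeling of $G$ is any map $p=(p_0,p_1): V(G)\to V(H)\times V(H)$. For $f\in\operatorname{Hom}(G\sqcup G,H)$ or $f\in \operatorname{Hom}(G\times K_2,H)$, $\operatorname{pair}(f)$ is the $H$-pair-labeling $v\mapsto (f(v_0),f(v_1))$. An edge $uv\in E(G)$ is safe with respect to $f$ if, with $p=\operatorname{pair}(f)$, $p_i(u)p_j(v)\in E(H)$ for all $i,j\in\{0,1\}$, and violated otherwise. A homomorphism $f\in\operatorname{Hom}(G\sqcup G,H)$ or $f\in\operatorname{Hom}(G\times K_2,H)$ has the bipartite swapping property if the edges of $G$ violated with respect to $f$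 form a bipartite subgraph of $G$. $H$ is a bipartite swapping target if for every finite simple graph $G$, every $f\in\operatorname{Hom}(G\sqcup G,H)$ has the bipartite swapping property. For $W\subseteq V(G)$, $\operatorname{swap}(p,W)$ is the $H$-pair-labeling obtained from $p$ by exchanging the two entries of $p(v)$ for each $v\in W$ (and leaving $p(v)$ unchanged for $v\notin W$). *)

theory Defs
  imports "Graph_Theory.Pair_Digraph" "HOL-Library.FuncSet"
begin

text \<open>
  An undirected edge \<open>uv\<close> is represented by the two arcs \<open>(u, v)\<close> and \<open>(v, u)\<close>, a loop at
  \<open>v\<close> by the arc \<open>(v, v)\<close>. Thus \<^locale>\<open>pair_graph\<close> describes the finite simple graphs and
  \<^locale>\<open>pair_pseudo_graph\<close> the finite graphs without multiple edges that may have loops.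
\<close>

text \<open>
  Homomorphisms are extensional functions (\<^const>\<open>undefined\<close> off the vertex set), so that
  equality in \<open>homs G H\<close> is equality of maps on the vertices of \<open>G\<close>.
\<close>

definition homs :: "'a pair_pre_digraph \<Rightarrow> 'b pair_pre_digraph \<Rightarrow> ('a \<Rightarrow> 'b) set" where
  "homs G H = {f \<in> pverts G \<rightarrow>\<^sub>E pverts H. \<forall>(u, v) \<in> parcs G. (f u, f v) \<in> parcs H}"

text \<open>
  The vertex \<open>v\<^sub>i\<close> is the pair \<open>(v, i)\<close>, where the indices 0 and 1 are \<^const>\<open>False\<close> and
  \<^const>\<open>True\<close>.
\<close>

definition two_copies :: "'a pair_pre_digraph \<Rightarrow> ('a \<times> bool) pair_pre_digraph" where
  "two_copies G =
    \<lparr> pverts = pverts G \<times> UNIV,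
      parcs = {((u, i), (v, i)) | u v i. (u, v) \<in> parcs G} \<rparr>"

definition times_K2 :: "'a pair_pre_digraph \<Rightarrow> ('a \<times> bool) pair_pre_digraph" where
  "times_K2 G =
    \<lparr> pverts = pverts G \<times> UNIV,
      parcs = {((u, i), (v, \<not> i)) | u v i. (u, v) \<in> parcs G} \<rparr>"

text \<open>Pair-labelings are extensional as well.\<close>

definition pair_of :: "'a pair_pre_digraph \<Rightarrow> ('a \<times> bool \<Rightarrow> 'b) \<Rightarrow> 'a \<Rightarrow> 'b \<times> 'b" where
  "pair_of G f = (\<lambda>v\<in>pverts G. (f (v, False), f (v, True)))"

definition entry :: "bool \<Rightarrow> 'b \<times> 'b \<Rightarrow> 'b" where
  "entry i x = (if i then snd x else fst x)"

definition swap_on :: "('a \<Rightarrow> 'b \<times> 'b) \<Rightarrow> 'a set \<Rightarrow> 'a \<Rightarrow> 'b \<times> 'b" where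
  "swap_on p W = (\<lambda>v. if v \<in> W then prod.swap (p v) else p v)"

definition safe ::
  "'a pair_pre_digraph \<Rightarrow> 'b pair_pre_digraph \<Rightarrow> ('a \<times> bool \<Rightarrow> 'b) \<Rightarrow> 'a \<Rightarrow> 'a \<Rightarrow> bool" where
  "safe G H f u v \<longleftrightarrow>
    (\<forall>i j. (entry i (pair_of G f u), entry j (pair_of G f v)) \<in> parcs H)"

definition violated_subgraph ::
  "'a pair_pre_digraph \<Rightarrow> 'b pair_pre_digraph \<Rightarrow> ('a \<times> bool \<Rightarrow> 'b) \<Rightarrow> 'a pair_pre_digraph" where
  "violated_subgraph G H f =
    \<lparr> pverts = pverts G, parcs = {(u, v) \<in> parcs G. \<not> safe G H f u v} \<rparr>"

definition bipartite :: "'a pair_pre_digraph \<Rightarrow> bool" where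
  "bipartite G \<longleftrightarrow>
    (\<exists>A B. pverts G = A \<union> B \<and> A \<inter> B = {} \<and> parcs G \<subseteq> A \<times> B \<union> B \<times> A)"

definition bipartite_swapping_property ::
  "'a pair_pre_digraph \<Rightarrow> 'b pair_pre_digraph \<Rightarrow> ('a \<times> bool \<Rightarrow> 'b) \<Rightarrow> bool" where
  "bipartite_swapping_property G H f \<longleftrightarrow> bipartite (violated_subgraph G H f)"

text \<open>
  HOL cannot quantify over types inside a definition. Graphs with vertices in \<^typ>\<open>nat\<close>
  represent all finite simple graphs up to isomorphism; the lemma below transfers the property
  to graphs over an arbitrary vertex type.
\<close>

definition bipartite_swapping_target :: "'b pair_pre_digraph \<Rightarrow> bool" where
  "bipartite_swapping_target H \<longleftrightarrow>
    (\<forall>G :: nat pair_pre_digraph. pair_graph G \<longrightarrow>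
      (\<forall>f \<in> homs (two_copies G) H. bipartite_swapping_property G H f))"

lemma bipartite_swapping_targetD:
  fixes G :: "'a pair_pre_digraph" and H :: "'b pair_pre_digraph"
  assumes H: "bipartite_swapping_target H" and G: "pair_graph G"
    and f: "f \<in> homs (two_copies G) H"
  shows "bipartite_swapping_property G H f"
proof -
  interpret pair_graph G by (rule G)
  obtain e :: "'a \<Rightarrow> nat" where e: "inj_on e (pverts G)"
    using finite_imp_inj_to_nat_seg[OF pair_finite_verts] by blast
  define d where "d = the_inv_into (pverts G) e"
  have d: "d (e v) = v" if "v \<in> pverts G" for v
    using the_inv_into_f_f[OF e that] by (simp add: d_def)
  define G' where "G' = \<lparr> pverts = e ` pverts G, parcs = map_prod e e ` parcs G \<rparr>"
  define f' where "f' = (\<lambda>x \<in> pverts G' \<times> UNIV. f (d (fst x), snd x))"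
  have G': "pair_graph G'"
  proof (unfold_locales)
    show "symmetric (with_proj G')"
      by (auto simp: symmetric_def sym_def G'_def image_iff dest: arcs_symmetric)
        (metis arcs_symmetric map_prod_simp)
    fix x assume "x \<in> parcs G'"
    then show "fst x \<in> pverts G'" "snd x \<in> pverts G'" "fst x \<noteq> snd x"
      using wellformed' no_loops' inj_onD[OF e] by (force simp: G'_def)+
  qed (auto simp: G'_def pair_finite_verts pair_finite_arcs)
  have f'_e: "f' (e v, i) = f (v, i)" if "v \<in> pverts G" for v i
    using that by (auto simp: f'_def G'_def d)
  have fH: "(f (u, i), f (v, i)) \<in> parcs H" if "(u, v) \<in> parcs G" for u v i
    using f that by (auto simp: homs_def two_copies_def)
  have fV: "f (v, i) \<in> pverts H" if "v \<in> pverts G" for v i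
    using f that by (auto simp: homs_def two_copies_def)
  have "f' \<in> pverts (two_copies G') \<rightarrow>\<^sub>E pverts H"
    by (auto simp: f'_def two_copies_def G'_def d fV)
  moreover have "(f' (x, i), f' (y, i)) \<in> parcs H" if "(x, y) \<in> parcs G'" for x y i
    using that wellformed' by (auto simp: G'_def f'_e fH)
  ultimately have "f' \<in> homs (two_copies G') H"
    by (auto simp: homs_def two_copies_def)
  then have "bipartite (violated_subgraph G' H f')"
    using H G' by (auto simp: bipartite_swapping_target_def bipartite_swapping_property_def)
  then obtain A B where AB: "pverts G' = A \<union> B" "A \<inter> B = {}"
    and viol: "{(u, v) \<in> parcs G'. \<not> safe G' H f' u v} \<subseteq> A \<times> B \<union> B \<times> A"
    by (auto simp: bipartite_def violated_subgraph_def)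
  have pair: "pair_of G' f' (e v) = pair_of G f v" if "v \<in> pverts G" for v
    using that by (auto simp: pair_of_def f'_e) (auto simp: G'_def)
  define A' where "A' = {v \<in> pverts G. e v \<in> A}"
  define B' where "B' = {v \<in> pverts G. e v \<in> B}"
  have "pverts G = A' \<union> B'" "A' \<inter> B' = {}"
    using AB by (auto simp: A'_def B'_def G'_def)
  moreover have "{(u, v) \<in> parcs G. \<not> safe G H f u v} \<subseteq> A' \<times> B' \<union> B' \<times> A'"
  proof (rule subrelI)
    fix u v assume "(u, v) \<in> {(u, v) \<in> parcs G. \<not> safe G H f u v}"
    then have uv: "(u, v) \<in> parcs G" "\<not> safe G H f u v" by auto
    then have V: "u \<in> pverts G" "v \<in> pverts G" using wellformed' by auto
    have "(e u, e v) \<in> {(u, v) \<in> parcs G'. \<not> safe G' H f' u v}"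
      using uv V by (force simp: safe_def pair G'_def[THEN arg_cong[where f = parcs]])
    then have "(e u, e v) \<in> A \<times> B \<union> B \<times> A" using viol by blast
    then show "(u, v) \<in> A' \<times> B' \<union> B' \<times> A'" using V by (auto simp: A'_def B'_def)
  qed
  ultimately show ?thesis
    unfolding bipartite_swapping_property_def bipartite_def violated_subgraph_def
    by (intro exI[of _ A'] exI[of _ B']) simp
qed

end

theory Submission
  imports Defs
begin

text \<open>
  Swapping the labels on a set \<open>W\<close> of vertices does not change which edges are safe, since an edge
  is safe when every label at one end is adjacent to every label at the other, irrespective of the
  order of the labels (\<open>safe_swap_labels\<close>). If \<open>f\<close> maps two disjoint copies of \<open>G\<close> to \<open>H\<close> and \<open>W\<close>
  is one side of a bipartition of the violated edges, then swapping on \<open>W\<close> turns \<open>f\<close> into a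
  homomorphism from \<open>G \<times> K\<^sub>2\<close>: safe edges survive any swap, and a violated edge is swapped at
  exactly one end, which exchanges its parallel edges for the crossing ones
  (\<open>swap_labels_in_homs\<close>).

  The remaining point is injectivity. The set \<open>W\<close> is chosen as a function of the set of violated
  edges alone, so two homomorphisms with the same violated edges are swapped on the same set. The
  image of \<open>f\<close> has the same violated edges as \<open>f\<close>, hence it determines \<open>W\<close>; and swapping on \<open>W\<close>
  once more recovers \<open>f\<close>.
\<close>

definition swap_labels :: "'a set \<Rightarrow> ('a \<times> bool \<Rightarrow> 'b) \<Rightarrow> 'a \<times> bool \<Rightarrow> 'b" where
  "swap_labels W f = (\<lambda>(v, i). f (v, if v \<in> W then \<not> i else i))"

lemma swap_labels_involution [simp]: "swap_labels W (swap_labels W f) = f"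
  by (auto simp: swap_labels_def fun_eq_iff)

lemma pair_of_swap_labels:
  assumes "W \<subseteq> pverts G"
  shows "pair_of G (swap_labels W f) = swap_on (pair_of G f) W"
  using assms by (auto simp: pair_of_def swap_labels_def swap_on_def fun_eq_iff)

lemma swap_labels_PiE:
  assumes "f \<in> V \<times> UNIV \<rightarrow>\<^sub>E X"
  shows "swap_labels W f \<in> V \<times> UNIV \<rightarrow>\<^sub>E X"
  using assms by (auto simp: swap_labels_def PiE_iff extensional_def)

lemma safe_iff:
  assumes "u \<in> pverts G" "v \<in> pverts G"
  shows "safe G H f u v \<longleftrightarrow> (\<forall>i j. (f (u, i), f (v, j)) \<in> parcs H)"
  using assms by (simp add: safe_def pair_of_def entry_def all_bool_eq)

lemma safe_swap_labels:
  assumes "u \<in> pverts G" "v \<in> pverts G"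
  shows "safe G H (swap_labels W f) u v \<longleftrightarrow> safe G H f u v"
  using assms by (auto simp: safe_iff swap_labels_def all_bool_eq)

lemma violated_subgraph_swap_labels:
  assumes "pair_wf_digraph G"
  shows "violated_subgraph G H (swap_labels W f) = violated_subgraph G H f"
proof -
  have "safe G H (swap_labels W f) u v \<longleftrightarrow> safe G H f u v" if "(u, v) \<in> parcs G" for u v
    using pair_wf_digraph.wellformed'[OF assms that] by (simp add: safe_swap_labels)
  then show ?thesis
    unfolding violated_subgraph_def by auto
qed

text \<open>
  Bipartitions are described by one of their sides, because that side is the set to be swapped.
\<close>

definition is_side :: "'a pair_pre_digraph \<Rightarrow> 'a set \<Rightarrow> bool" where
  "is_side G W \<longleftrightarrow> W \<subseteq> pverts G \<and> (\<forall>(u, v) \<in> parcs G. u \<in> W \<longleftrightarrow> v \<notin> W)"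

lemma bipartite_imp_is_side:
  assumes "bipartite G"
  shows "\<exists>W. is_side G W"
proof -
  obtain A B where "pverts G = A \<union> B" "A \<inter> B = {}" "parcs G \<subseteq> A \<times> B \<union> B \<times> A"
    using assms by (auto simp: bipartite_def)
  then have "is_side G A"
    by (auto simp: is_side_def)
  then show ?thesis ..
qed

lemma swap_labels_in_homs:
  assumes G: "pair_wf_digraph G" and f: "f \<in> homs (two_copies G) H"
    and W: "is_side (violated_subgraph G H f) W"
  shows "swap_labels W f \<in> homs (times_K2 G) H"
proof -
  have arc: "(swap_labels W f (u, i), swap_labels W f (v, \<not> i)) \<in> parcs H"
    if uv: "(u, v) \<in> parcs G" for u v i
  proof (cases "safe G H f u v")
    case True
    then show ?thesis
      using pair_wf_digraph.wellformed'[OF G uv] by (simp add: safe_iff swap_labels_def)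
  next
    case False
    then have "u \<in> W \<longleftrightarrow> v \<notin> W"
      using W uv by (auto simp: is_side_def violated_subgraph_def)
    \<comment> \<open>Swapping at one end only gives both ends of the crossing edge labels from the same copy.\<close>
    then have "(if u \<in> W then \<not> i else i) = (if v \<in> W then \<not> \<not> i else \<not> i)"
      by auto
    moreover have "(f (u, j), f (v, j)) \<in> parcs H" for j
      using f uv by (auto simp: homs_def two_copies_def)
    ultimately show ?thesis
      by (simp add: swap_labels_def)
  qed
  have "swap_labels W f \<in> pverts G \<times> UNIV \<rightarrow>\<^sub>E pverts H"
    using f by (intro swap_labels_PiE) (simp add: homs_def two_copies_def)
  then show ?thesis
    using arc by (auto simp: homs_def times_K2_def)
qed

theorem proposition4p4:
  fixes G :: "'a pair_pre_digraph" and H :: "'b pair_pre_digraph"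
  assumes "pair_pseudo_graph H"
    and "bipartite_swapping_target H"
    and "pair_graph G"
  shows "\<exists>\<phi>. \<phi> \<in> homs (two_copies G) H \<rightarrow> homs (times_K2 G) H
    \<and> inj_on \<phi> (homs (two_copies G) H)
    \<and> (\<forall>f \<in> homs (two_copies G) H.
          \<exists>W \<subseteq> pverts G. pair_of G (\<phi> f) = swap_on (pair_of G f) W)"
proof -
  interpret pair_graph G by (rule assms(3))
  have wf: "pair_wf_digraph G" ..
  \<comment> \<open>The chosen side is a function of the violated subgraph and of nothing else about \<open>f\<close>;
    injectivity rests on this.\<close>
  define side where "side = (\<lambda>M :: 'a pair_pre_digraph. SOME W. is_side M W)"
  define \<phi> where "\<phi> f = swap_labels (side (violated_subgraph G H f)) f" for f
  have side: "is_side (violated_subgraph G H f) (side (violated_subgraph G H f))"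
    if "f \<in> homs (two_copies G) H" for f
  proof -
    have "bipartite (violated_subgraph G H f)"
      using bipartite_swapping_targetD[OF assms(2,3) that]
      by (simp add: bipartite_swapping_property_def)
    then show ?thesis
      unfolding side_def by (rule someI_ex[OF bipartite_imp_is_side])
  qed
  have "\<phi> f \<in> homs (times_K2 G) H" if "f \<in> homs (two_copies G) H" for f
    unfolding \<phi>_def using wf that side[OF that] by (rule swap_labels_in_homs)
  moreover have "inj_on \<phi> (homs (two_copies G) H)"
  proof (rule inj_on_inverseI)
    fix f
    have "violated_subgraph G H (\<phi> f) = violated_subgraph G H f"
      unfolding \<phi>_def by (rule violated_subgraph_swap_labels[OF wf])
    then show "swap_labels (side (violated_subgraph G H (\<phi> f))) (\<phi> f) = f"
      by (simp add: \<phi>_def)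
  qed
  moreover have "\<exists>W \<subseteq> pverts G. pair_of G (\<phi> f) = swap_on (pair_of G f) W"
    if "f \<in> homs (two_copies G) H" for f
  proof -
    have "side (violated_subgraph G H f) \<subseteq> pverts G"
      using side[OF that] by (simp add: is_side_def violated_subgraph_def)
    then show ?thesis
      unfolding \<phi>_def using pair_of_swap_labels by blast
  qed
  ultimately show ?thesis
    by (intro exI[of _ \<phi>]) blast
qed

end
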